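(* Let $K$ be a regular CW complex, let $U$ and $W$ be subcomplexes of $K$ with $K = U \cup W$, and suppose $U$, $W$ are in antithetic position, i.e. $(U\cap W)[n] = U[n]\cap W[n]$ for all $n\ge 0$. Let $\alpha$ be an algorithm that is uniformly $k$-local for some $k \ge 1$. Then $$V_{\alpha}(K) = \bigl(V_{\alpha}(U[k]) \cup V_{\alpha}(W[k])\bigr) \setminus \Bigl( V_{\alpha}\bigl((U\cap W)[k]\bigr) \setminus V_{\alpha}\bigl((U\cap W)[2k+1]\bigr) \Bigr).$$
   Context: All complexes are regular CW complexes (characteristic maps of cells are homeomorphisms onto the closures of the cells). Neighborhoods. Two cells of a complex $K$ are adjacent if their closures have a point in common. The star of a cell $\sigma$ is the smallest subcomplex of $K$ containing all cells adjacent to $\sigma$. The star of a collection of cells is the smallest subcomplex containing the stars of all cells in the collection. For a subcomplex $K'$ of $K$, $K'[0]=K'$, $K'[1]$ is the star of $K'$ in $K$, and $K'[n+1]$ is the star of $K'[n]$; $K'[n]$ is the $n$-neighborhood of $K'$ in $K$. Likewise for a cell $\sigma$, $\sigma[1]$ is its star and $\sigma[n+1]$ is the star of $\sigma[n]$. For a subcomplex $C$ of $K$ and a cell $\sigma$ of $C$, $\sigma_C[k]$ denotes the $k$-neighborhood of $\sigma$ formed intrinsically within the complex $C$; thus $\sigma_K[k]=\sigma[k]$. All neighborhoods $U[n]$, $W[n]$, $(U\cap W)[n]$ are formed in $K$. Algorithms and vector fields. A pair $(\sigma \le \tau)$ denotes a cell $\tau$ with a codimension $1$ face $\sigma$. An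 algorithm $\alpha$, using fixed data attached to the cells of $K$ (restricted to subcomplexes when applied to them), assigns to each subcomplex $C$ of $K$ (including $K$ itself) a discrete vector field $V_{\alpha}(C)$, i.e. a set of pairs $(\sigma\le\tau)$ of cells of $C$ that is the discrete gradient vector field of some discrete Morse function on $C$. The algorithm is uniformly $k$-local ($k>0$ fixed) if, for each pair $(\sigma\le\tau)$ of cells in $C$, the decision whether $(\sigma\le\tau)\in V_{\alpha}(C)$ is based only on data coming from $\sigma_C[k]$. In particular, if $C$, $C'$ are subcomplexes of $K$ both containing $\sigma$ and $\tau$ and $\sigma_C[k]=\sigma_{C'}[k]$, then $(\sigma\le\tau)\in V_{\alpha}(C)$ if and only if $(\sigma\le\tau)\in V_{\alpha}(C')$. *)

theory Defs
  imports "HOL-Analysis.Analysis"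
begin

subsection \<open>Regular CW complexes\<close>

definition unit_disc :: "nat \<Rightarrow> (nat \<Rightarrow> real) topology" where
  "unit_disc n = subtopology (Euclidean_space n) {x. (\<Sum>i<n. (x i)\<^sup>2) \<le> 1}"

text \<open>The members of \<open>cells K n\<close> are the open \<open>n\<close>-cells, as subsets of the underlying space.\<close>

record 'a cell_complex =
  carrier_top :: "'a topology"
  cells :: "nat \<Rightarrow> 'a set set"

definition all_cells :: "'a cell_complex \<Rightarrow> 'a set set" where
  "all_cells K = (\<Union>n. cells K n)"

definition cell_closure :: "'a cell_complex \<Rightarrow> 'a set \<Rightarrow> 'a set" where
  "cell_closure K \<sigma> = carrier_top K closure_of \<sigma>"

text \<open>The last conjunct combines the condition that the boundary sphere is mapped into cells of
  lower dimension with closure finiteness.\<close>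

definition characteristic_map ::
  "'a cell_complex \<Rightarrow> nat \<Rightarrow> 'a set \<Rightarrow> ((nat \<Rightarrow> real) \<Rightarrow> 'a) \<Rightarrow> bool" where
  "characteristic_map K n \<sigma> \<phi> \<longleftrightarrow>
     continuous_map (unit_disc n) (carrier_top K) \<phi> \<and>
     homeomorphic_map (subtopology (unit_disc n) {x. (\<Sum>i<n. (x i)\<^sup>2) < 1})
                      (subtopology (carrier_top K) \<sigma>) \<phi> \<and>
     (\<exists>F. finite F \<and> F \<subseteq> (\<Union>m<n. cells K m) \<and>
          \<phi> ` {x \<in> topspace (unit_disc n). (\<Sum>i<n. (x i)\<^sup>2) = 1} \<subseteq> \<Union>F)"

definition cw_complex :: "'a cell_complex \<Rightarrow> bool" where
  "cw_complex K \<longleftrightarrow>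
     Hausdorff_space (carrier_top K) \<and>
     \<Union>(all_cells K) = topspace (carrier_top K) \<and>
     (\<forall>m n. \<forall>\<sigma>\<in>cells K m. \<forall>\<tau>\<in>cells K n. (m, \<sigma>) \<noteq> (n, \<tau>) \<longrightarrow> \<sigma> \<inter> \<tau> = {}) \<and>
     (\<forall>n. \<forall>\<sigma>\<in>cells K n. \<exists>\<phi>. characteristic_map K n \<sigma> \<phi>) \<and>
     (\<forall>A \<subseteq> topspace (carrier_top K).
        (\<forall>\<sigma>\<in>all_cells K. closedin (carrier_top K) (A \<inter> cell_closure K \<sigma>)) \<longrightarrow>
        closedin (carrier_top K) A)"

definition regular_cw_complex :: "'a cell_complex \<Rightarrow> bool" where
  "regular_cw_complex K \<longleftrightarrow>
     cw_complex K \<and>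
     (\<forall>n. \<forall>\<sigma>\<in>cells K n. \<exists>\<phi>. characteristic_map K n \<sigma> \<phi> \<and>
        homeomorphic_map (unit_disc n)
          (subtopology (carrier_top K) (cell_closure K \<sigma>)) \<phi>)"

text \<open>Subcomplexes are represented by their sets of cells; since the cells partition the space,
  unions and intersections of cell sets and of underlying spaces correspond.
  \<open>complex_of K C\<close> is the subcomplex \<open>C\<close> as a complex in its own right.\<close>

definition subcomplex :: "'a cell_complex \<Rightarrow> 'a set set \<Rightarrow> bool" where
  "subcomplex K C \<longleftrightarrow> C \<subseteq> all_cells K \<and> (\<forall>\<sigma>\<in>C. cell_closure K \<sigma> \<subseteq> \<Union>C)"

definition complex_of :: "'a cell_complex \<Rightarrow> 'a set set \<Rightarrow> 'a cell_complex" where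
  "complex_of K C = \<lparr>carrier_top = subtopology (carrier_top K) (\<Union>C), cells = (\<lambda>n. cells K n \<inter> C)\<rparr>"

lemma complex_of_all_cells:
  assumes "cw_complex K"
  shows "complex_of K (all_cells K) = K"
proof -
  have "cells K n \<inter> all_cells K = cells K n" for n
    by (auto simp: all_cells_def)
  moreover have "\<Union>(all_cells K) = topspace (carrier_top K)"
    using assms by (simp add: cw_complex_def)
  ultimately show ?thesis
    by (simp add: complex_of_def)
qed

definition generated_subcomplex :: "'a cell_complex \<Rightarrow> 'a set set \<Rightarrow> 'a set set" where
  "generated_subcomplex K A = \<Inter>{C. subcomplex K C \<and> A \<subseteq> C}"


subsection \<open>Neighborhoods\<close>

definition adjacent :: "'a cell_complex \<Rightarrow> 'a set \<Rightarrow> 'a set \<Rightarrow> bool" where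
  "adjacent K \<sigma> \<tau> \<longleftrightarrow> \<sigma> \<in> all_cells K \<and> \<tau> \<in> all_cells K \<and>
     cell_closure K \<sigma> \<inter> cell_closure K \<tau> \<noteq> {}"

definition cell_star :: "'a cell_complex \<Rightarrow> 'a set \<Rightarrow> 'a set set" where
  "cell_star K \<sigma> = generated_subcomplex K {\<tau>. adjacent K \<sigma> \<tau>}"

definition star :: "'a cell_complex \<Rightarrow> 'a set set \<Rightarrow> 'a set set" where
  "star K S = generated_subcomplex K (\<Union>\<sigma>\<in>S. cell_star K \<sigma>)"

definition nbhd :: "'a cell_complex \<Rightarrow> 'a set set \<Rightarrow> nat \<Rightarrow> 'a set set" where
  "nbhd K S n = (star K ^^ n) S"

text \<open>Neighborhoods of a single cell start at \<open>n = 1\<close>, where the value is the star of the cell;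
  the value at \<open>n = 0\<close> has no meaning.\<close>

definition cell_nbhd :: "'a cell_complex \<Rightarrow> 'a set \<Rightarrow> nat \<Rightarrow> 'a set set" where
  "cell_nbhd K \<sigma> n = (star K ^^ (n - 1)) (cell_star K \<sigma>)"

definition antithetic :: "'a cell_complex \<Rightarrow> 'a set set \<Rightarrow> 'a set set \<Rightarrow> bool" where
  "antithetic K U W \<longleftrightarrow> (\<forall>n. nbhd K (U \<inter> W) n = nbhd K U n \<inter> nbhd K W n)"


subsection \<open>Discrete vector fields and local algorithms\<close>

definition facet :: "'a cell_complex \<Rightarrow> 'a set \<Rightarrow> 'a set \<Rightarrow> bool" where
  "facet K \<sigma> \<tau> \<longleftrightarrow>
     (\<exists>n. \<sigma> \<in> cells K n \<and> \<tau> \<in> cells K (Suc n) \<and> \<sigma> \<subseteq> cell_closure K \<tau>)"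

text \<open>Forman's discrete Morse functions and their gradient vector fields.\<close>

definition discrete_morse_function :: "'a cell_complex \<Rightarrow> ('a set \<Rightarrow> real) \<Rightarrow> bool" where
  "discrete_morse_function K f \<longleftrightarrow>
     (\<forall>\<sigma>\<in>all_cells K.
        (\<exists>\<^sub>\<le>\<^sub>1 \<tau>. facet K \<sigma> \<tau> \<and> f \<tau> \<le> f \<sigma>) \<and>
        (\<exists>\<^sub>\<le>\<^sub>1 \<upsilon>. facet K \<upsilon> \<sigma> \<and> f \<upsilon> \<ge> f \<sigma>))"

definition gradient_field ::
  "'a cell_complex \<Rightarrow> ('a set \<Rightarrow> real) \<Rightarrow> ('a set \<times> 'a set) set" where
  "gradient_field K f = {(\<sigma>, \<tau>). facet K \<sigma> \<tau> \<and> f \<tau> \<le> f \<sigma>}"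

definition discrete_vector_field ::
  "'a cell_complex \<Rightarrow> ('a set \<times> 'a set) set \<Rightarrow> bool" where
  "discrete_vector_field K V \<longleftrightarrow>
     (\<exists>f. discrete_morse_function K f \<and> V = gradient_field K f)"

text \<open>An algorithm takes a complex together with data attached to its cells (a partial map whose
  domain is the set of cells) and returns a set of pairs of cells. On a subcomplex \<open>C\<close> of \<open>K\<close> it
  is run with the fixed data of \<open>K\<close> restricted to \<open>C\<close>.\<close>

type_synonym ('a, 'd) algorithm =
  "'a cell_complex \<Rightarrow> ('a set \<rightharpoonup> 'd) \<Rightarrow> ('a set \<times> 'a set) set"

definition alg_field ::
  "'a cell_complex \<Rightarrow> ('a set \<rightharpoonup> 'd) \<Rightarrow> ('a, 'd) algorithm \<Rightarrow> 'a set set \<Rightarrow> ('a set \<times> 'a set) set"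
  where "alg_field K data \<alpha> C = \<alpha> (complex_of K C) (data |` C)"

definition vector_field_algorithm ::
  "'a cell_complex \<Rightarrow> ('a set \<rightharpoonup> 'd) \<Rightarrow> ('a, 'd) algorithm \<Rightarrow> bool" where
  "vector_field_algorithm K data \<alpha> \<longleftrightarrow>
     dom data = all_cells K \<and>
     (\<forall>C. subcomplex K C \<longrightarrow> discrete_vector_field (complex_of K C) (alg_field K data \<alpha> C))"

text \<open>The decision about a pair is a function of the complex \<open>\<sigma>\<^sub>C[k]\<close> and the data on its cells.\<close>

definition uniformly_local ::
  "'a cell_complex \<Rightarrow> ('a set \<rightharpoonup> 'd) \<Rightarrow> ('a, 'd) algorithm \<Rightarrow> nat \<Rightarrow> bool" where
  "uniformly_local K data \<alpha> k \<longleftrightarrow>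
     k > 0 \<and>
     (\<exists>decide. \<forall>C \<sigma> \<tau>. subcomplex K C \<and> facet (complex_of K C) \<sigma> \<tau> \<longrightarrow>
        ((\<sigma>, \<tau>) \<in> alg_field K data \<alpha> C \<longleftrightarrow>
         (let N = cell_nbhd (complex_of K C) \<sigma> k
          in decide (complex_of K N) (data |` N) \<sigma> \<tau>)))"

end

theory Submission imports Defs begin

text \<open>
  Write \<open>D = U \<inter> W\<close>. Everything rests on one observation (\<open>field_agrees_on_subcomplex\<close>): if
  \<open>C' \<subseteq> C\<close> are subcomplexes and the neighborhood \<open>\<sigma>\<^sub>C[k]\<close> happens to lie in \<open>C'\<close>, then it
  coincides with \<open>\<sigma>\<^sub>C\<^sub>'[k]\<close>, so a \<open>k\<close>-local algorithm treats the pairs \<open>(\<sigma>, \<tau>)\<close> alike in \<open>C\<close> and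
  \<open>C'\<close>. The theorem follows by locating \<open>\<sigma>\<close>.

  If \<open>\<sigma>\<close> is in \<open>U\<close>, then \<open>\<sigma>[k] \<subseteq> U[k]\<close>, so \<open>K\<close> and \<open>U[k]\<close> agree at \<open>\<sigma>\<close>; likewise for \<open>W\<close>. If
  \<open>\<sigma>\<close> is in \<open>D[k]\<close>, then \<open>\<sigma>[k] \<subseteq> D[2k] \<subseteq> D[2k+1]\<close>, so \<open>K\<close> and \<open>D[2k+1]\<close> agree at \<open>\<sigma>\<close>. Hence the
  set subtracted on the right contains exactly the pairs that the algorithm selects in \<open>D[k]\<close> but
  not in \<open>K\<close>, and every pair selected in \<open>K\<close> survives.

  Conversely, \<open>V(U[k])\<close> may contain pairs that \<open>V(K)\<close> does not, but only at cells
  \<open>\<sigma>\<close> of \<open>U[k]\<close> outside \<open>U\<close>, which therefore lie in \<open>W\<close>. There the neighborhood of \<open>\<sigma>\<close> formed in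
  \<open>U[k]\<close> is contained in \<open>U[k] \<inter> W[k]\<close>, which is \<open>D[k]\<close> by antithetic position. So \<open>U[k]\<close> and
  \<open>D[k]\<close> agree at \<open>\<sigma>\<close>, and such a pair is removed by the subtraction.
\<close>

section \<open>Cells and generated subcomplexes\<close>

lemma cell_nonempty:
  assumes "cw_complex K" and "\<sigma> \<in> all_cells K"
  shows "\<sigma> \<noteq> {}"
proof -
  obtain n where "\<sigma> \<in> cells K n"
    using assms(2) by (auto simp: all_cells_def)
  moreover have "\<forall>n. \<forall>\<sigma>\<in>cells K n. \<exists>\<phi>. characteristic_map K n \<sigma> \<phi>"
    using assms(1) unfolding cw_complex_def by (elim conjE)
  ultimately obtain \<phi> where "characteristic_map K n \<sigma> \<phi>"
    by blast
  then have "homeomorphic_map (subtopology (unit_disc n) {x. (\<Sum>i<n. (x i)\<^sup>2) < 1})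
      (subtopology (carrier_top K) \<sigma>) \<phi>"
    by (simp add: characteristic_map_def)
  then have "\<phi> ` topspace (subtopology (unit_disc n) {x. (\<Sum>i<n. (x i)\<^sup>2) < 1}) =
      topspace (subtopology (carrier_top K) \<sigma>)"
    by (rule homeomorphic_imp_surjective_map)
  \<comment> \<open>The center of the open disc is mapped into the cell.\<close>
  moreover have "(\<lambda>_. 0) \<in> topspace (subtopology (unit_disc n) {x. (\<Sum>i<n. (x i)\<^sup>2) < 1})"
    by (simp add: unit_disc_def topspace_Euclidean_space)
  ultimately have "topspace (subtopology (carrier_top K) \<sigma>) \<noteq> {}"
    by blast
  then show ?thesis
    by auto
qed

lemma cell_subset_closure:
  assumes "cw_complex K" and "\<sigma> \<in> all_cells K"
  shows "\<sigma> \<subseteq> cell_closure K \<sigma>"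
  using assms unfolding cell_closure_def cw_complex_def
  by (intro closure_of_subset) auto

lemma adjacent_refl:
  assumes "cw_complex K" and "\<sigma> \<in> all_cells K"
  shows "adjacent K \<sigma> \<sigma>"
  using cell_nonempty[OF assms] cell_subset_closure[OF assms] assms(2)
  by (auto simp: adjacent_def)

lemma cells_disjoint:
  assumes "cw_complex K" and "\<sigma> \<in> all_cells K" and "\<tau> \<in> all_cells K" and "\<sigma> \<noteq> \<tau>"
  shows "\<sigma> \<inter> \<tau> = {}"
proof -
  have "\<forall>m n. \<forall>\<sigma>\<in>cells K m. \<forall>\<tau>\<in>cells K n. (m, \<sigma>) \<noteq> (n, \<tau>) \<longrightarrow> \<sigma> \<inter> \<tau> = {}"
    using assms(1) unfolding cw_complex_def by (elim conjE)
  moreover obtain m n where "\<sigma> \<in> cells K m" "\<tau> \<in> cells K n"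
    using assms(2,3) unfolding all_cells_def by blast
  ultimately show ?thesis
    using assms(4) by simp
qed

lemma subcomplex_all_cells:
  assumes "cw_complex K"
  shows "subcomplex K (all_cells K)"
proof -
  have "\<Union>(all_cells K) = topspace (carrier_top K)"
    using assms by (simp add: cw_complex_def)
  then show ?thesis
    by (simp add: subcomplex_def cell_closure_def closure_of_subset_topspace)
qed

text \<open>Disjointness of the cells makes the space underlying an intersection of cell sets the
  intersection of the underlying spaces.\<close>

lemma subcomplex_Inter:
  assumes cw: "cw_complex K" and ne: "\<C> \<noteq> {}" and sub: "\<And>C. C \<in> \<C> \<Longrightarrow> subcomplex K C"
  shows "subcomplex K (\<Inter>\<C>)"
  unfolding subcomplex_def
proof (intro conjI ballI subsetI)
  show "\<sigma> \<in> all_cells K" if "\<sigma> \<in> \<Inter>\<C>" for \<sigma>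
    using that ne sub unfolding subcomplex_def by blast
next
  fix \<sigma> x assume \<sigma>: "\<sigma> \<in> \<Inter>\<C>" and x: "x \<in> cell_closure K \<sigma>"
  have cover: "\<exists>\<rho>\<in>C. x \<in> \<rho> \<and> \<rho> \<in> all_cells K" if "C \<in> \<C>" for C
    using that \<sigma> x sub[OF that] unfolding subcomplex_def by blast
  obtain C\<^sub>0 where "C\<^sub>0 \<in> \<C>"
    using ne by blast
  from cover[OF this] obtain \<rho> where \<rho>: "x \<in> \<rho>" "\<rho> \<in> all_cells K"
    by blast
  have "\<rho> \<in> C" if "C \<in> \<C>" for C
    using cover[OF that] cells_disjoint[OF cw \<rho>(2)] \<rho>(1) by blast
  then show "x \<in> \<Union>(\<Inter>\<C>)"
    using \<rho>(1) by blast
qed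

lemma subcomplex_Int:
  assumes "cw_complex K" and "subcomplex K A" and "subcomplex K B"
  shows "subcomplex K (A \<inter> B)"
  using subcomplex_Inter[of K "{A, B}"] assms by auto

lemma subset_generated: "A \<subseteq> generated_subcomplex K A"
  by (auto simp: generated_subcomplex_def)

lemma generated_least:
  assumes "subcomplex K C" and "A \<subseteq> C"
  shows "generated_subcomplex K A \<subseteq> C"
  using assms by (auto simp: generated_subcomplex_def)

lemma generated_mono:
  assumes "A \<subseteq> B"
  shows "generated_subcomplex K A \<subseteq> generated_subcomplex K B"
  unfolding generated_subcomplex_def
  by (intro Inter_anti_mono Collect_mono impI) (meson assms subset_trans)

lemma subcomplex_generated:
  assumes "cw_complex K" and "A \<subseteq> all_cells K"
  shows "subcomplex K (generated_subcomplex K A)"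
  unfolding generated_subcomplex_def
  using assms subcomplex_all_cells by (intro subcomplex_Inter) auto

lemma generated_Union:
  "generated_subcomplex K (\<Union>i\<in>I. generated_subcomplex K (A i)) =
   generated_subcomplex K (\<Union>i\<in>I. A i)"
proof
  show "generated_subcomplex K (\<Union>i\<in>I. generated_subcomplex K (A i))
      \<subseteq> generated_subcomplex K (\<Union>i\<in>I. A i)"
    unfolding generated_subcomplex_def[of K "\<Union>i\<in>I. A i"]
  proof (rule Inter_greatest)
    fix C assume "C \<in> {C. subcomplex K C \<and> (\<Union>i\<in>I. A i) \<subseteq> C}"
    then have C: "subcomplex K C" and A: "(\<Union>i\<in>I. A i) \<subseteq> C"
      by simp_all
    have "generated_subcomplex K (A i) \<subseteq> C" if "i \<in> I" for i
      using C A that by (intro generated_least) blast+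
    then show "generated_subcomplex K (\<Union>i\<in>I. generated_subcomplex K (A i)) \<subseteq> C"
      by (rule generated_least[OF C UN_least])
  qed
  show "generated_subcomplex K (\<Union>i\<in>I. A i)
      \<subseteq> generated_subcomplex K (\<Union>i\<in>I. generated_subcomplex K (A i))"
    by (intro generated_mono UN_mono subset_refl subset_generated)
qed

section \<open>Passing to a subcomplex\<close>

lemma all_cells_complex_of:
  assumes "subcomplex K C"
  shows "all_cells (complex_of K C) = C"
  using assms by (auto simp: subcomplex_def all_cells_def complex_of_def)

lemma cell_closure_complex_of:
  assumes "subcomplex K C" and "\<sigma> \<in> C"
  shows "cell_closure (complex_of K C) \<sigma> = cell_closure K \<sigma>"
proof -
  have "\<sigma> \<subseteq> \<Union>C" and "carrier_top K closure_of \<sigma> \<subseteq> \<Union>C"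
    using assms by (auto simp: subcomplex_def cell_closure_def)
  then show ?thesis
    by (simp add: cell_closure_def complex_of_def closure_of_subtopology Int_absorb1 Int_absorb2)
qed

lemma subcomplex_complex_of:
  assumes "subcomplex K C"
  shows "subcomplex (complex_of K C) X \<longleftrightarrow> subcomplex K X \<and> X \<subseteq> C"
proof -
  have "(\<forall>\<sigma>\<in>X. cell_closure (complex_of K C) \<sigma> \<subseteq> \<Union>X) \<longleftrightarrow>
      (\<forall>\<sigma>\<in>X. cell_closure K \<sigma> \<subseteq> \<Union>X)" if "X \<subseteq> C"
    using that by (intro ball_cong refl) (simp add: cell_closure_complex_of[OF assms] subset_iff)
  moreover have "C \<subseteq> all_cells K"
    using assms by (simp add: subcomplex_def)
  ultimately show ?thesis
    using all_cells_complex_of[OF assms] by (auto simp only: subcomplex_def)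
qed

lemma adjacent_complex_of:
  assumes "subcomplex K C"
  shows "adjacent (complex_of K C) \<sigma> \<tau> \<longleftrightarrow> adjacent K \<sigma> \<tau> \<and> \<sigma> \<in> C \<and> \<tau> \<in> C"
  using assms cell_closure_complex_of[OF assms] all_cells_complex_of[OF assms]
  unfolding adjacent_def subcomplex_def by auto

lemma facet_complex_of:
  assumes "subcomplex K C"
  shows "facet (complex_of K C) \<sigma> \<tau> \<longleftrightarrow> facet K \<sigma> \<tau> \<and> \<sigma> \<in> C \<and> \<tau> \<in> C"
  using cell_closure_complex_of[OF assms]
  by (auto simp: facet_def complex_of_def)

text \<open>The subcomplex of \<open>K\<close> generated by cells of \<open>C\<close> stays in \<open>C\<close>, so only the choice of
  generators distinguishes neighborhoods in \<open>C\<close> from those in \<open>K\<close>.\<close>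

lemma generated_complex_of:
  assumes cw: "cw_complex K" and C: "subcomplex K C" and A: "A \<subseteq> C"
  shows "generated_subcomplex (complex_of K C) A = generated_subcomplex K A"
proof
  have "subcomplex K (generated_subcomplex K A)"
    using assms by (intro subcomplex_generated) (auto simp: subcomplex_def)
  then show "generated_subcomplex (complex_of K C) A \<subseteq> generated_subcomplex K A"
    using generated_least[OF C A] subset_generated
    by (intro generated_least) (auto simp: subcomplex_complex_of[OF C])
  show "generated_subcomplex K A \<subseteq> generated_subcomplex (complex_of K C) A"
    unfolding generated_subcomplex_def subcomplex_complex_of[OF C]
    by (intro Inter_anti_mono Collect_mono) blast
qed

lemma facet_imp_adjacent:
  assumes "cw_complex K" and "facet K \<sigma> \<tau>"
  shows "adjacent K \<sigma> \<tau>"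
proof -
  have "\<sigma> \<in> all_cells K" "\<tau> \<in> all_cells K" "\<sigma> \<subseteq> cell_closure K \<tau>"
    using assms(2) by (auto simp: facet_def all_cells_def)
  then show ?thesis
    using cell_nonempty[OF assms(1)] cell_subset_closure[OF assms(1)]
    unfolding adjacent_def by blast
qed

section \<open>Neighborhoods\<close>

lemma star_eq_generated:
  "star K S = generated_subcomplex K {\<tau>. \<exists>\<sigma>\<in>S. adjacent K \<sigma> \<tau>}"
proof -
  have "(\<Union>\<sigma>\<in>S. {\<tau>. adjacent K \<sigma> \<tau>}) = {\<tau>. \<exists>\<sigma>\<in>S. adjacent K \<sigma> \<tau>}"
    by auto
  then show ?thesis
    by (simp add: star_def cell_star_def generated_Union)
qed

text \<open>From index \<open>1\<close> on, the neighborhoods of a cell are those of the set consisting of that cell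
  alone, although this set is in general not a subcomplex. This reduces both kinds of
  neighborhood to one.\<close>

lemma cell_nbhd_eq_nbhd:
  assumes "k \<ge> 1"
  shows "cell_nbhd K \<sigma> k = nbhd K {\<sigma>} k"
proof -
  have "cell_star K \<sigma> = star K {\<sigma>}"
    by (simp add: star_eq_generated cell_star_def)
  then show ?thesis
    using assms by (cases k) (simp_all add: cell_nbhd_def nbhd_def funpow_swap1)
qed

lemma nbhd_0: "nbhd K S 0 = S"
  by (simp add: nbhd_def)

lemma nbhd_Suc: "nbhd K S (Suc n) = star K (nbhd K S n)"
  by (simp add: nbhd_def)

lemma nbhd_nbhd: "nbhd K (nbhd K S m) n = nbhd K S (n + m)"
  by (simp add: nbhd_def funpow_add)

lemma subcomplex_star:
  assumes "cw_complex K"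
  shows "subcomplex K (star K S)"
  unfolding star_eq_generated
  using assms by (intro subcomplex_generated) (auto simp: adjacent_def)

lemma subcomplex_nbhd:
  assumes "cw_complex K" and "subcomplex K S"
  shows "subcomplex K (nbhd K S n)"
  using assms by (cases n) (simp_all add: nbhd_0 nbhd_Suc subcomplex_star)

lemma star_complex_of:
  assumes "cw_complex K" and C: "subcomplex K C" and "S \<subseteq> C"
  shows "star (complex_of K C) S = generated_subcomplex K {\<tau> \<in> C. \<exists>\<sigma>\<in>S. adjacent K \<sigma> \<tau>}"
proof -
  have "{\<tau>. \<exists>\<sigma>\<in>S. adjacent (complex_of K C) \<sigma> \<tau>} = {\<tau> \<in> C. \<exists>\<sigma>\<in>S. adjacent K \<sigma> \<tau>}"
    using assms(3) by (auto simp: adjacent_complex_of[OF C])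
  then show ?thesis
    by (simp add: star_eq_generated generated_complex_of[OF assms(1,2)])
qed

lemma nbhd_complex_of_subset:
  assumes "cw_complex K" and C: "subcomplex K C" and "S \<subseteq> C"
  shows "nbhd (complex_of K C) S n \<subseteq> C"
proof (induction n)
  case 0
  then show ?case
    using assms(3) by (simp add: nbhd_0)
next
  case (Suc n)
  then show ?case
    unfolding nbhd_Suc star_complex_of[OF assms(1,2) Suc]
    by (intro generated_least[OF C]) auto
qed

lemma nbhd_complex_of_mono:
  assumes cw: "cw_complex K" and C: "subcomplex K C" and C': "subcomplex K C'"
    and "C' \<subseteq> C" and "S' \<subseteq> S" and "S' \<subseteq> C'" and "S \<subseteq> C"
  shows "nbhd (complex_of K C') S' n \<subseteq> nbhd (complex_of K C) S n"
proof (induction n)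
  case 0
  then show ?case
    using assms by (simp add: nbhd_0)
next
  case (Suc n)
  show ?case
    unfolding nbhd_Suc
      star_complex_of[OF cw C nbhd_complex_of_subset[OF cw C \<open>S \<subseteq> C\<close>]]
      star_complex_of[OF cw C' nbhd_complex_of_subset[OF cw C' \<open>S' \<subseteq> C'\<close>]]
    using Suc \<open>C' \<subseteq> C\<close> by (intro generated_mono) blast
qed

lemma neighbor_in_nbhd_Suc:
  assumes cw: "cw_complex K" and C: "subcomplex K C" and "S \<subseteq> C"
    and "\<sigma> \<in> nbhd (complex_of K C) S n" and "\<tau> \<in> C" and "adjacent K \<sigma> \<tau>"
  shows "\<tau> \<in> nbhd (complex_of K C) S (Suc n)"
  unfolding nbhd_Suc star_complex_of[OF cw C nbhd_complex_of_subset[OF cw C \<open>S \<subseteq> C\<close>]]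
  using assms(4-6) by (intro subsetD[OF subset_generated]) blast

lemma nbhd_increasing:
  assumes cw: "cw_complex K" and C: "subcomplex K C" and "S \<subseteq> C" and "m \<le> n"
  shows "nbhd (complex_of K C) S m \<subseteq> nbhd (complex_of K C) S n"
proof -
  have "\<sigma> \<in> nbhd (complex_of K C) S (Suc i)" if \<sigma>: "\<sigma> \<in> nbhd (complex_of K C) S i" for \<sigma> i
  proof -
    have "\<sigma> \<in> C"
      using \<sigma> nbhd_complex_of_subset[OF cw C \<open>S \<subseteq> C\<close>] by blast
    moreover from this have "adjacent K \<sigma> \<sigma>"
      using C by (intro adjacent_refl[OF cw]) (auto simp: subcomplex_def)
    ultimately show ?thesis
      by (rule neighbor_in_nbhd_Suc[OF cw C \<open>S \<subseteq> C\<close> \<sigma>])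
  qed
  then have "nbhd (complex_of K C) S i \<subseteq> nbhd (complex_of K C) S (Suc i)" for i
    by (intro subsetI)
  then show ?thesis
    using \<open>m \<le> n\<close> by (rule lift_Suc_mono_le)
qed

text \<open>Each stage of the neighborhood in \<open>C\<close> lies below the last one, hence in \<open>C'\<close>; so the stars
  taken on the way meet no cell of \<open>C\<close> that is missing from \<open>C'\<close>.\<close>

lemma nbhd_eq_if_contained:
  assumes cw: "cw_complex K" and C: "subcomplex K C" and C': "subcomplex K C'"
    and "C' \<subseteq> C" and "S \<subseteq> C'" and "nbhd (complex_of K C) S n \<subseteq> C'"
  shows "nbhd (complex_of K C') S n = nbhd (complex_of K C) S n"
  using assms(6)
proof (induction n)
  case 0
  then show ?case
    by (simp add: nbhd_0)
next
  case (Suc n)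
  let ?N = "nbhd (complex_of K C) S n"
  have SC: "S \<subseteq> C"
    using assms(4,5) by blast
  have N: "?N \<subseteq> C'"
    using nbhd_increasing[OF cw C SC, of n "Suc n"] Suc.prems by simp
  have "{\<tau> \<in> C. \<exists>\<sigma>\<in>?N. adjacent K \<sigma> \<tau>} = {\<tau> \<in> C'. \<exists>\<sigma>\<in>?N. adjacent K \<sigma> \<tau>}"
    using neighbor_in_nbhd_Suc[OF cw C SC] Suc.prems \<open>C' \<subseteq> C\<close> by blast
  then have "star (complex_of K C') ?N = star (complex_of K C) ?N"
    using N \<open>C' \<subseteq> C\<close> by (simp add: star_complex_of[OF cw C] star_complex_of[OF cw C'])
  then show ?case
    using Suc.IH[OF N] by (simp add: nbhd_Suc)
qed

lemma cell_nbhd_subset_nbhd: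
  assumes cw: "cw_complex K" and "S \<subseteq> all_cells K" and "\<sigma> \<in> S" and "k \<ge> 1"
  shows "cell_nbhd K \<sigma> k \<subseteq> nbhd K S k"
  using nbhd_complex_of_mono[OF cw subcomplex_all_cells[OF cw] subcomplex_all_cells[OF cw],
      of "{\<sigma>}" S k] assms
  by (auto simp: complex_of_all_cells cell_nbhd_eq_nbhd)

section \<open>Local algorithms\<close>

lemma alg_field_facet:
  assumes "vector_field_algorithm K data \<alpha>" and "subcomplex K C"
    and "(\<sigma>, \<tau>) \<in> alg_field K data \<alpha> C"
  shows "facet (complex_of K C) \<sigma> \<tau>"
  using assms
  by (fastforce simp: vector_field_algorithm_def discrete_vector_field_def gradient_field_def)

lemma field_agrees_on_subcomplex:
  assumes cw: "cw_complex K" and vf: "vector_field_algorithm K data \<alpha>"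
    and loc: "uniformly_local K data \<alpha> k"
    and C: "subcomplex K C" and C': "subcomplex K C'" and "C' \<subseteq> C" and "\<sigma> \<in> C'"
    and N: "cell_nbhd (complex_of K C) \<sigma> k \<subseteq> C'"
  shows "(\<sigma>, \<tau>) \<in> alg_field K data \<alpha> C \<longleftrightarrow> (\<sigma>, \<tau>) \<in> alg_field K data \<alpha> C'"
proof (cases "facet (complex_of K C) \<sigma> \<tau>")
  case False
  then have "\<not> facet (complex_of K C') \<sigma> \<tau>"
    using \<open>C' \<subseteq> C\<close> by (auto simp: facet_complex_of[OF C] facet_complex_of[OF C'])
  with False show ?thesis
    using alg_field_facet[OF vf] C C' by blast
next
  case True
  have k: "k \<ge> 1"
    using loc by (simp add: uniformly_local_def)
  have \<sigma>C: "{\<sigma>} \<subseteq> C" and \<sigma>C': "{\<sigma>} \<subseteq> C'"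
    using assms(6,7) by auto
  have N': "nbhd (complex_of K C) {\<sigma>} k \<subseteq> C'"
    using N by (simp add: cell_nbhd_eq_nbhd[OF k])
  have fac: "facet K \<sigma> \<tau>" and \<tau>C: "\<tau> \<in> C"
    using True by (auto simp: facet_complex_of[OF C])
  \<comment> \<open>The coface \<open>\<tau>\<close> touches \<open>\<sigma>\<close>, so it is already in the star of \<open>\<sigma>\<close>, and the pair lives in \<open>C'\<close>.\<close>
  have "\<tau> \<in> nbhd (complex_of K C) {\<sigma>} (Suc 0)"
    using facet_imp_adjacent[OF cw fac] \<tau>C
    by (intro neighbor_in_nbhd_Suc[OF cw C \<sigma>C]) (auto simp: nbhd_0)
  then have "\<tau> \<in> C'"
    using nbhd_increasing[OF cw C \<sigma>C, of "Suc 0" k] k N' by auto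
  then have fac': "facet (complex_of K C') \<sigma> \<tau>"
    using fac \<open>\<sigma> \<in> C'\<close> by (simp add: facet_complex_of[OF C'])
  have eq: "cell_nbhd (complex_of K C') \<sigma> k = cell_nbhd (complex_of K C) \<sigma> k"
    using nbhd_eq_if_contained[OF cw C C' \<open>C' \<subseteq> C\<close> \<sigma>C' N']
    by (simp add: cell_nbhd_eq_nbhd[OF k])
  obtain decide where decide: "\<And>C \<sigma> \<tau>. subcomplex K C \<Longrightarrow> facet (complex_of K C) \<sigma> \<tau> \<Longrightarrow>
      (\<sigma>, \<tau>) \<in> alg_field K data \<alpha> C \<longleftrightarrow>
      (let N = cell_nbhd (complex_of K C) \<sigma> k in decide (complex_of K N) (data |` N) \<sigma> \<tau>)"
    using loc unfolding uniformly_local_def by blast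
  show ?thesis
    using decide[OF C True] decide[OF C' fac'] eq by simp
qed

text \<open>Since \<open>\<sigma>[k] \<subseteq> S[k]\<close> for every cell \<open>\<sigma>\<close> of \<open>S\<close>, any subcomplex containing \<open>S[k]\<close> sees the full
  neighborhood of \<open>\<sigma>\<close>. This is applied with \<open>S = U\<close>, \<open>S = W\<close> and \<open>S = (U \<inter> W)[k]\<close>.\<close>

lemma field_agrees_near:
  assumes cw: "cw_complex K" and vf: "vector_field_algorithm K data \<alpha>"
    and loc: "uniformly_local K data \<alpha> k"
    and "S \<subseteq> all_cells K" and "\<sigma> \<in> S" and C: "subcomplex K C" and sub: "nbhd K S k \<subseteq> C"
  shows "(\<sigma>, \<tau>) \<in> alg_field K data \<alpha> (all_cells K) \<longleftrightarrow> (\<sigma>, \<tau>) \<in> alg_field K data \<alpha> C"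
proof (rule field_agrees_on_subcomplex[OF cw vf loc subcomplex_all_cells[OF cw] C])
  have k: "k \<ge> 1"
    using loc by (simp add: uniformly_local_def)
  show "C \<subseteq> all_cells K"
    using C by (simp add: subcomplex_def)
  show "cell_nbhd (complex_of K (all_cells K)) \<sigma> k \<subseteq> C"
    using cell_nbhd_subset_nbhd[OF cw assms(4,5) k] sub by (simp add: complex_of_all_cells[OF cw])
  show "\<sigma> \<in> C"
    using nbhd_increasing[OF cw subcomplex_all_cells[OF cw] assms(4), of 0 k] assms(5) sub
    by (auto simp: complex_of_all_cells[OF cw] nbhd_0)
qed

text \<open>Only antithetic position controls the cells near the cut edge of \<open>U[k]\<close>: the neighborhood of
  a cell of \<open>W\<close> formed inside \<open>U[k]\<close> is confined to \<open>W[k]\<close> as well, hence to \<open>(U \<inter> W)[k]\<close>.\<close>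

lemma field_agrees_across:
  assumes cw: "cw_complex K" and vf: "vector_field_algorithm K data \<alpha>"
    and loc: "uniformly_local K data \<alpha> k"
    and U: "subcomplex K U" and W: "subcomplex K W"
    and anti: "nbhd K (U \<inter> W) k = nbhd K U k \<inter> nbhd K W k"
    and "\<sigma> \<in> W" and "\<sigma> \<in> nbhd K U k"
  shows "\<sigma> \<in> nbhd K (U \<inter> W) k"
    and "(\<sigma>, \<tau>) \<in> alg_field K data \<alpha> (nbhd K U k) \<longleftrightarrow>
         (\<sigma>, \<tau>) \<in> alg_field K data \<alpha> (nbhd K (U \<inter> W) k)"
proof -
  have k: "k \<ge> 1"
    using loc by (simp add: uniformly_local_def)
  note top = subcomplex_all_cells[OF cw]
  have Wc: "W \<subseteq> all_cells K"
    using W by (simp add: subcomplex_def)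
  have Uk: "subcomplex K (nbhd K U k)"
    by (rule subcomplex_nbhd[OF cw U])
  then have Ukc: "nbhd K U k \<subseteq> all_cells K"
    by (simp add: subcomplex_def)
  have Dk: "subcomplex K (nbhd K (U \<inter> W) k)"
    by (intro subcomplex_nbhd[OF cw] subcomplex_Int[OF cw U W])
  show \<sigma>D: "\<sigma> \<in> nbhd K (U \<inter> W) k"
    using nbhd_increasing[OF cw top Wc, of 0 k] assms(7,8)
    by (auto simp: anti complex_of_all_cells[OF cw] nbhd_0)
  have "nbhd (complex_of K (nbhd K U k)) {\<sigma>} k \<subseteq> nbhd K W k"
    using nbhd_complex_of_mono[OF cw top Uk Ukc, of "{\<sigma>}" W k] assms(7,8) Wc
    by (simp add: complex_of_all_cells[OF cw])
  moreover have "nbhd (complex_of K (nbhd K U k)) {\<sigma>} k \<subseteq> nbhd K U k"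
    using assms(8) by (intro nbhd_complex_of_subset[OF cw Uk]) simp
  ultimately have "cell_nbhd (complex_of K (nbhd K U k)) \<sigma> k \<subseteq> nbhd K (U \<inter> W) k"
    by (simp add: anti cell_nbhd_eq_nbhd[OF k])
  moreover have "nbhd K (U \<inter> W) k \<subseteq> nbhd K U k"
    by (simp add: anti)
  ultimately show "(\<sigma>, \<tau>) \<in> alg_field K data \<alpha> (nbhd K U k) \<longleftrightarrow>
         (\<sigma>, \<tau>) \<in> alg_field K data \<alpha> (nbhd K (U \<inter> W) k)"
    using field_agrees_on_subcomplex[OF cw vf loc Uk Dk] \<sigma>D by blast
qed

section \<open>The decomposition formula\<close>

theorem corollary3p5:
  fixes K :: "'a cell_complex" and U W :: "'a set set"
    and data :: "'a set \<rightharpoonup> 'd" and \<alpha> :: "('a, 'd) algorithm" and k :: nat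
  assumes "regular_cw_complex K"
    and "subcomplex K U" and "subcomplex K W"
    and "all_cells K = U \<union> W"
    and "antithetic K U W"
    and "vector_field_algorithm K data \<alpha>"
    and "k \<ge> 1" and "uniformly_local K data \<alpha> k"
  defines "V \<equiv> alg_field K data \<alpha>"
  shows "V (all_cells K) =
     (V (nbhd K U k) \<union> V (nbhd K W k)) -
     (V (nbhd K (U \<inter> W) k) - V (nbhd K (U \<inter> W) (2 * k + 1)))"
proof -
  have cw: "cw_complex K"
    using assms(1) by (simp add: regular_cw_complex_def)
  note U = assms(2) and W = assms(3) and vf = assms(6) and loc = assms(8)
  let ?D = "U \<inter> W"
  note top = subcomplex_all_cells[OF cw]
  have Uc: "U \<subseteq> all_cells K" and Wc: "W \<subseteq> all_cells K"
    using assms(4) by auto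
  have D: "subcomplex K ?D"
    by (rule subcomplex_Int[OF cw U W])
  have Dk: "subcomplex K (nbhd K ?D n)" for n
    by (rule subcomplex_nbhd[OF cw D])
  then have Dc: "nbhd K ?D n \<subseteq> all_cells K" for n
    by (simp add: subcomplex_def)
  have anti: "nbhd K ?D k = nbhd K U k \<inter> nbhd K W k"
    using assms(5) by (simp add: antithetic_def)
  have anti': "nbhd K (W \<inter> U) k = nbhd K W k \<inter> nbhd K U k"
    using anti by (simp add: Int_commute)
  have atU: "(\<sigma>, \<tau>) \<in> V (all_cells K) \<longleftrightarrow> (\<sigma>, \<tau>) \<in> V (nbhd K U k)" if "\<sigma> \<in> U" for \<sigma> \<tau>
    unfolding V_def
    using field_agrees_near[OF cw vf loc Uc that subcomplex_nbhd[OF cw U]] by simp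
  have atW: "(\<sigma>, \<tau>) \<in> V (all_cells K) \<longleftrightarrow> (\<sigma>, \<tau>) \<in> V (nbhd K W k)" if "\<sigma> \<in> W" for \<sigma> \<tau>
    unfolding V_def
    using field_agrees_near[OF cw vf loc Wc that subcomplex_nbhd[OF cw W]] by simp
  have "nbhd K (nbhd K ?D k) k \<subseteq> nbhd K ?D (2 * k + 1)"
    using nbhd_increasing[OF cw top, of ?D "k + k" "2 * k + 1"] Uc
    by (auto simp: nbhd_nbhd complex_of_all_cells[OF cw])
  then have atD: "(\<sigma>, \<tau>) \<in> V (all_cells K) \<longleftrightarrow> (\<sigma>, \<tau>) \<in> V (nbhd K ?D (2 * k + 1))"
    if "\<sigma> \<in> nbhd K ?D k" for \<sigma> \<tau>
    unfolding V_def using field_agrees_near[OF cw vf loc Dc that Dk] by simp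
  have acrossU: "\<sigma> \<in> nbhd K ?D k \<and> ((\<sigma>, \<tau>) \<in> V (nbhd K U k) \<longleftrightarrow> (\<sigma>, \<tau>) \<in> V (nbhd K ?D k))"
    if "\<sigma> \<in> W" "\<sigma> \<in> nbhd K U k" for \<sigma> \<tau>
    unfolding V_def using field_agrees_across[OF cw vf loc U W anti that] by simp
  have acrossW: "\<sigma> \<in> nbhd K ?D k \<and> ((\<sigma>, \<tau>) \<in> V (nbhd K W k) \<longleftrightarrow> (\<sigma>, \<tau>) \<in> V (nbhd K ?D k))"
    if "\<sigma> \<in> U" "\<sigma> \<in> nbhd K W k" for \<sigma> \<tau>
    unfolding V_def using field_agrees_across[OF cw vf loc W U anti' that]
    by (simp add: Int_commute)
  have V_cell: "\<sigma> \<in> C" if "subcomplex K C" "(\<sigma>, \<tau>) \<in> V C" for \<sigma> \<tau> C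
    using alg_field_facet[OF vf that(1)] that(2) unfolding V_def
    by (simp add: facet_complex_of[OF that(1)])
  have inD: "\<sigma> \<in> nbhd K ?D k" if "(\<sigma>, \<tau>) \<in> V (nbhd K ?D k)" for \<sigma> \<tau>
    using V_cell[OF Dk that] .
  have inU: "\<sigma> \<in> nbhd K U k" if "(\<sigma>, \<tau>) \<in> V (nbhd K U k)" for \<sigma> \<tau>
    using V_cell[OF subcomplex_nbhd[OF cw U] that] .
  have inW: "\<sigma> \<in> nbhd K W k" if "(\<sigma>, \<tau>) \<in> V (nbhd K W k)" for \<sigma> \<tau>
    using V_cell[OF subcomplex_nbhd[OF cw W] that] .
  have inK: "\<sigma> \<in> U \<or> \<sigma> \<in> W" if "\<sigma> \<in> all_cells K" for \<sigma>
    using that assms(4) by auto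
  have "(\<sigma>, \<tau>) \<in> V (all_cells K) \<longleftrightarrow>
      ((\<sigma>, \<tau>) \<in> V (nbhd K U k) \<or> (\<sigma>, \<tau>) \<in> V (nbhd K W k)) \<and>
      \<not> ((\<sigma>, \<tau>) \<in> V (nbhd K ?D k) \<and> (\<sigma>, \<tau>) \<notin> V (nbhd K ?D (2 * k + 1)))" (is "?L \<longleftrightarrow> ?R")
    for \<sigma> \<tau>
  proof
    assume ?L
    then show ?R
      using inK[OF V_cell[OF top]] atU atW atD inD by blast
  next
    assume R: ?R
    have "?L" if "(\<sigma>, \<tau>) \<in> V (nbhd K U k)"
    proof (cases "\<sigma> \<in> U")
      case False
      then have "\<sigma> \<in> W"
        using inU[OF that] subcomplex_nbhd[OF cw U] assms(4) by (auto simp: subcomplex_def)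
      then show ?thesis
        using acrossU[OF _ inU[OF that]] atD that R by blast
    qed (use atU that in blast)
    moreover have "?L" if "(\<sigma>, \<tau>) \<in> V (nbhd K W k)"
    proof (cases "\<sigma> \<in> W")
      case False
      then have "\<sigma> \<in> U"
        using inW[OF that] subcomplex_nbhd[OF cw W] assms(4) by (auto simp: subcomplex_def)
      then show ?thesis
        using acrossW[OF _ inW[OF that]] atD that R by blast
    qed (use atW that in blast)
    ultimately show ?L
      using R by blast
  qed
  then show ?thesis
    by auto
qed

end
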